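(* Let $X$ be a real Banach space. Then every convex body in $X$ can be approximated, with respect to the Hausdorff metric, by locally uniformly convex bodies (that is, for every convex body $B\subset X$ and every $\varepsilon>0$ there is a locally uniformly convex body $C\subset X$ with $d_H(B,C)<\varepsilon$) if and only if $X$ admits an equivalent locally uniformly convex norm.
   Context: A convex body in a real Banach space $X$ is a closed bounded convex set with nonempty interior. For convex bodies $A,B$, the Hausdorff metric is $d_H(A,B)=\inf\{r>0: A\subset \overline{B+rB_X},\ B\subset\overline{A+rB_X}\}$, where $B_X$ is the closed unit ball of $X$. For a closed convex set $C$ with $0\in\operatorname{int}C$, its Minkowski functional is $p_C(x)=\inf\{\lambda>0: x\in\lambda C\}$. A convex body $B$ with $0\in\operatorname{int}(B)$ is locally uniformly convex if for each $x\in\operatorname{bd}(B)$ and every sequence $\{x_n\}\subset\operatorname{bd}(B)$ with $p_B(x+x_n)\to 2$ one has $x_n\to x$. A general convex body $B$ is locally uniformly convex if there is $x_0\in\operatorname{int}(B)$ such that $B-x_0$ is locally uniformly convex in the preceding sense. A norm $\|\cdot\|$ is locally uniformly convex if for every $x$ with $\|x\|=1$ and every sequence $\{x_n\}$ with $\|x_n\|=1$ and $\|x+x_n\|\to2$ one has $x_n\to x$. *)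

theory Defs
  imports "HOL-Analysis.Analysis" "HOL-Library.Set_Algebras"
begin

definition convex_body :: "'a::real_normed_vector set \<Rightarrow> bool" where
  "convex_body B \<longleftrightarrow> closed B \<and> bounded B \<and> convex B \<and> interior B \<noteq> {}"

(* Inf is the infimum of a set of reals. It is meaningful whenever A and B are nonempty and
   bounded, since then some r > 0 is admissible. The sum of sets is the Minkowski sum. *)
definition hausdorff_distance :: "'a::real_normed_vector set \<Rightarrow> 'a set \<Rightarrow> real" where
  "hausdorff_distance A B =
     Inf {r. 0 < r \<and> A \<subseteq> closure (B + (*\<^sub>R) r ` cball 0 1)
                  \<and> B \<subseteq> closure (A + (*\<^sub>R) r ` cball 0 1)}"

definition minkowski_functional :: "'a::real_vector set \<Rightarrow> 'a \<Rightarrow> real" where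
  "minkowski_functional C x = Inf {t. 0 < t \<and> x \<in> (*\<^sub>R) t ` C}"

definition luc_body_at_origin :: "'a::real_normed_vector set \<Rightarrow> bool" where
  "luc_body_at_origin B \<longleftrightarrow>
     convex_body B \<and> 0 \<in> interior B \<and>
     (\<forall>x \<in> frontier B. \<forall>xs :: nat \<Rightarrow> 'a.
        (\<forall>n. xs n \<in> frontier B) \<longrightarrow>
        (\<lambda>n. minkowski_functional B (x + xs n)) \<longlonglongrightarrow> 2 \<longrightarrow>
        xs \<longlonglongrightarrow> x)"

definition locally_uniformly_convex_body :: "'a::real_normed_vector set \<Rightarrow> bool" where
  "locally_uniformly_convex_body B \<longleftrightarrow>
     convex_body B \<and> (\<exists>x0 \<in> interior B. luc_body_at_origin ((\<lambda>x. x - x0) ` B))"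

definition is_norm :: "('a::real_vector \<Rightarrow> real) \<Rightarrow> bool" where
  "is_norm N \<longleftrightarrow>
     (\<forall>x. 0 \<le> N x) \<and>
     (\<forall>x. N x = 0 \<longleftrightarrow> x = 0) \<and>
     (\<forall>a x. N (a *\<^sub>R x) = \<bar>a\<bar> * N x) \<and>
     (\<forall>x y. N (x + y) \<le> N x + N y)"

definition equivalent_norm :: "('a::real_normed_vector \<Rightarrow> real) \<Rightarrow> bool" where
  "equivalent_norm N \<longleftrightarrow>
     is_norm N \<and> (\<exists>c > 0. \<exists>d > 0. \<forall>x. c * norm x \<le> N x \<and> N x \<le> d * norm x)"

(* Convergence of the sequence is taken in N itself, so that the notion depends on N alone;
   for an equivalent norm it coincides with convergence in the ambient norm. *)
definition locally_uniformly_convex_norm :: "('a::real_vector \<Rightarrow> real) \<Rightarrow> bool" where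
  "locally_uniformly_convex_norm N \<longleftrightarrow>
     is_norm N \<and>
     (\<forall>x. N x = 1 \<longrightarrow> (\<forall>xs :: nat \<Rightarrow> 'a.
        (\<forall>n. N (xs n) = 1) \<longrightarrow>
        (\<lambda>n. N (x + xs n)) \<longlonglongrightarrow> 2 \<longrightarrow>
        (\<lambda>n. N (xs n - x)) \<longlonglongrightarrow> 0))"

end

theory Submission
  imports Defs
begin

text \<open>
  Both directions rest on one observation: if \<open>f\<close> and \<open>g\<close> are Minkowski functionals of bodies
  around the origin and \<open>f\<close> is locally uniformly convex, then so is
  \<open>q = sqrt (f\<^sup>2 + g\<^sup>2)\<close>, because \<open>2 q(x)\<^sup>2 + 2 q(y)\<^sup>2 - q(x + y)\<^sup>2\<close> dominates the corresponding
  expression for \<open>f\<close>, which in turn dominates \<open>(f(x) - f(y))\<^sup>2\<close>.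
  Given a locally uniformly convex norm \<open>N\<close> and a body with functional \<open>p\<close>, take \<open>f = \<delta> N\<close> and
  \<open>g = p\<close> for a small \<open>\<delta>\<close>. Conversely, a single locally uniformly convex body, with functional
  \<open>p\<close>, gives a norm by symmetrisation: \<open>f(x) = p(x)\<close> and \<open>g(x) = p(-x)\<close>.
\<close>

section \<open>Gauge functions: asymmetric norms comparable to the ambient norm\<close>

text \<open>These turn out to be exactly the Minkowski functionals of convex bodies with 0 in the
  interior. Homogeneity is only positive because bodies need not be symmetric. The lower norm bound
  corresponds to boundedness of the body, the upper one to 0 being interior.\<close>

definition gauge_function :: "('a::real_normed_vector \<Rightarrow> real) \<Rightarrow> bool" where
  "gauge_function p \<longleftrightarrow>
     (\<forall>x y. p (x + y) \<le> p x + p y) \<and>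
     (\<forall>c x. 0 \<le> c \<longrightarrow> p (c *\<^sub>R x) = c * p x) \<and>
     (\<exists>a>0. \<forall>x. a * norm x \<le> p x) \<and>
     (\<exists>b>0. \<forall>x. p x \<le> b * norm x)"

text \<open>The homogeneous form of local uniform convexity, which is invariant under scaling of \<open>p\<close>.\<close>

definition luc_gauge :: "('a::real_normed_vector \<Rightarrow> real) \<Rightarrow> bool" where
  "luc_gauge p \<longleftrightarrow>
     (\<forall>x xs. (\<lambda>n. p (xs n)) \<longlonglongrightarrow> p x \<longrightarrow> (\<lambda>n. p (x + xs n)) \<longlonglongrightarrow> 2 * p x \<longrightarrow> xs \<longlonglongrightarrow> x)"

lemma gauge_functionD:
  assumes "gauge_function p"
  shows "p (x + y) \<le> p x + p y" "0 \<le> c \<Longrightarrow> p (c *\<^sub>R x) = c * p x"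
    "0 \<le> p x" "p 0 = 0" "p x = 0 \<longleftrightarrow> x = 0"
proof -
  show "p (x + y) \<le> p x + p y" "0 \<le> c \<Longrightarrow> p (c *\<^sub>R x) = c * p x"
    using assms by (auto simp: gauge_function_def)
  obtain a where a: "a > 0" "\<And>x. a * norm x \<le> p x"
    using assms by (auto simp: gauge_function_def)
  have "0 \<le> a * norm x" using a(1) by simp
  then show nn: "0 \<le> p x" using a(2)[of x] by linarith
  have "p (0 *\<^sub>R 0) = 0 * p 0" using assms unfolding gauge_function_def by blast
  then show p0: "p 0 = 0" by simp
  show "p x = 0 \<longleftrightarrow> x = 0"
    using a(1) a(2)[of x] p0 by (auto simp: mult_le_0_iff)
qed

lemma gauge_function_lipschitz:
  assumes "gauge_function p"
  obtains b where "b > 0" "\<And>x y. \<bar>p x - p y\<bar> \<le> b * norm (x - y)"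
proof -
  obtain b where b: "b > 0" "\<And>x. p x \<le> b * norm x"
    using assms by (auto simp: gauge_function_def)
  have *: "p x - p y \<le> b * norm (x - y)" for x y
    using gauge_functionD(1)[OF assms, of y "x - y"] b(2)[of "x - y"] by simp
  have "\<bar>p x - p y\<bar> \<le> b * norm (x - y)" for x y
    using *[of x y] *[of y x] by (simp add: abs_le_iff norm_minus_commute)
  with b(1) show ?thesis using that by blast
qed

text \<open>A Lipschitz function transfers limits between asymptotically equal sequences. Two
  sequences are used because neither has to converge itself.\<close>

lemma gauge_function_tendsto:
  assumes "gauge_function p" "(\<lambda>n::nat. f n - g n) \<longlonglongrightarrow> 0" "(\<lambda>n. p (g n)) \<longlonglongrightarrow> l"
  shows "(\<lambda>n. p (f n)) \<longlonglongrightarrow> l"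
proof -
  obtain b where b: "b > 0" "\<And>x y. \<bar>p x - p y\<bar> \<le> b * norm (x - y)"
    using gauge_function_lipschitz[OF assms(1)] by blast
  have "(\<lambda>n. b * norm (f n - g n)) \<longlonglongrightarrow> 0"
    using tendsto_mult_left[OF tendsto_norm_zero[OF assms(2)], of b] by simp
  then have "(\<lambda>n. p (f n) - p (g n)) \<longlonglongrightarrow> 0"
    by (rule Lim_null_comparison[rotated]) (simp add: b(2))
  from tendsto_add[OF this assms(3)] show ?thesis by simp
qed

lemma gauge_function_continuous:
  assumes "gauge_function p"
  shows "continuous_on UNIV p"
proof -
  obtain b where b: "b > 0" "\<And>x y. \<bar>p x - p y\<bar> \<le> b * norm (x - y)"
    using gauge_function_lipschitz[OF assms] by blast
  have "b-lipschitz_on UNIV p"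
    using b by (auto intro!: lipschitz_onI simp: dist_norm less_imp_le)
  then show ?thesis by (rule lipschitz_on_continuous_on)
qed

lemma gauge_function_null_sequence:
  assumes "gauge_function p" "(\<lambda>n. p (xs n)) \<longlonglongrightarrow> 0"
  shows "xs \<longlonglongrightarrow> 0"
proof -
  obtain a where a: "a > 0" "\<And>x. a * norm x \<le> p x"
    using assms by (auto simp: gauge_function_def)
  have "(\<lambda>n. p (xs n) / a) \<longlonglongrightarrow> 0"
    using tendsto_divide[OF assms(2) tendsto_const[of a]] a(1) by simp
  then show ?thesis
    by (rule Lim_null_comparison[rotated]) (simp add: a pos_le_divide_eq mult.commute)
qed

text \<open>Reduces the homogeneous form to the unit sphere. For \<open>x = 0\<close> the lower norm
  bound suffices; otherwise \<open>x\<close> and the \<open>xs n\<close> are normalised, and the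
  normalising factors \<open>p (xs n)\<close> converge to \<open>p x > 0\<close>.\<close>

lemma luc_gaugeI:
  assumes p: "gauge_function p"
    and luc: "\<And>x xs. p x = 1 \<Longrightarrow> (\<And>n::nat. p (xs n) = 1) \<Longrightarrow> (\<lambda>n. p (x + xs n)) \<longlonglongrightarrow> 2 \<Longrightarrow> xs \<longlonglongrightarrow> x"
  shows "luc_gauge p"
  unfolding luc_gauge_def
proof (intro allI impI)
  fix x xs
  assume l1: "(\<lambda>n. p (xs n)) \<longlonglongrightarrow> p x" and l2: "(\<lambda>n. p (x + xs n)) \<longlonglongrightarrow> 2 * p x"
  show "xs \<longlonglongrightarrow> x"
  proof (cases "x = 0")
    case True
    then show ?thesis
      using l1 gauge_function_null_sequence[OF p] gauge_functionD(4)[OF p] by simp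
  next
    case False
    define s where "s = p x"
    have s: "s > 0"
      using False gauge_functionD(3,5)[OF p, of x] by (simp add: s_def)
    define u where "u = (1 / s) *\<^sub>R x"
    \<comment> \<open>The default \<open>u\<close> puts every \<open>y n\<close> on the unit sphere;
      it occurs for finitely many \<open>n\<close> only, since \<open>p (xs n)\<close> tends to
      \<open>s > 0\<close>.\<close>
    define y where "y n = (if p (xs n) = 0 then u else (1 / p (xs n)) *\<^sub>R xs n)" for n
    have pu: "p u = 1"
      using s gauge_functionD(2)[OF p, of "1 / s" x] by (simp add: u_def s_def)
    have py: "p (y n) = 1" for n
      using pu gauge_functionD(2)[OF p, of "1 / p (xs n)" "xs n"] gauge_functionD(3)[OF p, of "xs n"]
      by (simp add: y_def)
    have "\<forall>\<^sub>F n in sequentially. p (xs n) > 0"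
      using order_tendstoD(1)[OF l1] s by (simp add: s_def)
    then have xs_y: "\<forall>\<^sub>F n in sequentially. p (xs n) *\<^sub>R y n = xs n"
      by eventually_elim (simp add: y_def)
    obtain a where a: "a > 0" "\<And>x. a * norm x \<le> p x"
      using p by (auto simp: gauge_function_def)
    have y_bound: "norm (y n) \<le> 1 / a" for n
      using a(1) a(2)[of "y n"] by (simp add: py pos_le_divide_eq mult.commute)
    have "(\<lambda>n. (p (xs n) - s) / s) \<longlonglongrightarrow> (p x - s) / s"
      using s by (intro tendsto_intros l1) auto
    then have "(\<lambda>n. (p (xs n) - s) / s) \<longlonglongrightarrow> 0"
      by (simp add: s_def)
    moreover have "Bfun y sequentially"
      by (rule BfunI[of _ "1 / a"]) (simp add: y_bound)
    ultimately have "(\<lambda>n. ((p (xs n) - s) / s) *\<^sub>R y n) \<longlonglongrightarrow> 0"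
      using bounded_bilinear.Zfun_prod_Bfun[OF bounded_bilinear_scaleR]
      by (simp add: tendsto_Zfun_iff)
    from tendsto_minus[OF this]
    have *: "(\<lambda>n. - (((p (xs n) - s) / s) *\<^sub>R y n)) \<longlonglongrightarrow> 0"
      by simp
    \<comment> \<open>Eventually \<open>xs n\<close> is \<open>p (xs n)\<close> times
      \<open>y n\<close>, so this difference is \<open>y n\<close> times
      \<open>1 - p (xs n) / s\<close>: a bounded sequence times a null one.\<close>
    have diff: "(\<lambda>n. (u + y n) - (1 / s) *\<^sub>R (x + xs n)) \<longlonglongrightarrow> 0"
      using *
    proof (rule Lim_transform_eventually)
      show "\<forall>\<^sub>F n in sequentially. - (((p (xs n) - s) / s) *\<^sub>R y n) = (u + y n) - (1 / s) *\<^sub>R (x + xs n)"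
        using xs_y
      proof eventually_elim
        case (elim n)
        have "(1 / s) *\<^sub>R xs n = (p (xs n) / s) *\<^sub>R y n"
          using arg_cong[OF elim, of "\<lambda>z. (1 / s) *\<^sub>R z"] by simp
        then show ?case
          using s by (simp add: u_def scaleR_add_right diff_divide_distrib scaleR_diff_left)
      qed
    qed
    have "(\<lambda>n. p ((1 / s) *\<^sub>R (x + xs n))) \<longlonglongrightarrow> 2"
    proof -
      have "(\<lambda>n. (1 / s) * p (x + xs n)) \<longlonglongrightarrow> (1 / s) * (2 * p x)"
        by (intro tendsto_intros l2)
      then show ?thesis
        using s gauge_functionD(2)[OF p, of "1 / s"] by (simp add: s_def)
    qed
    then have "(\<lambda>n. p (u + y n)) \<longlonglongrightarrow> 2"
      by (rule gauge_function_tendsto[OF p diff])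
    then have "y \<longlonglongrightarrow> u"
      by (rule luc[OF pu py])
    then have "(\<lambda>n. p (xs n) *\<^sub>R y n) \<longlonglongrightarrow> p x *\<^sub>R u"
      by (intro tendsto_intros l1)
    then have "(\<lambda>n. p (xs n) *\<^sub>R y n) \<longlonglongrightarrow> x"
      using s by (simp add: u_def s_def)
    then show ?thesis
      by (rule Lim_transform_eventually) (rule xs_y)
  qed
qed

section \<open>Reflection, scaling and quadratic sums of gauge functions\<close>

lemma gauge_function_uminus:
  assumes "gauge_function p"
  shows "gauge_function (\<lambda>x. p (- x))"
proof -
  obtain a b where "a > 0" "\<And>x. a * norm x \<le> p x" "b > 0" "\<And>x. p x \<le> b * norm x"
    using assms by (auto simp: gauge_function_def)
  then have "\<And>x. a * norm x \<le> p (- x)" "\<And>x. p (- x) \<le> b * norm x"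
    by (metis norm_minus_cancel)+
  moreover have "p (- (x + y)) \<le> p (- x) + p (- y)" for x y
    using gauge_functionD(1)[OF assms, of "- x" "- y"] by simp
  moreover have "p (- (c *\<^sub>R x)) = c * p (- x)" if "0 \<le> c" for c x
    using gauge_functionD(2)[OF assms that, of "- x"] by simp
  ultimately show ?thesis
    using \<open>a > 0\<close> \<open>b > 0\<close> unfolding gauge_function_def by blast
qed

lemma gauge_function_scale:
  assumes "gauge_function p" "d > 0"
  shows "gauge_function (\<lambda>x. d * p x)"
proof -
  obtain a b where ab: "a > 0" "\<And>x. a * norm x \<le> p x" "b > 0" "\<And>x. p x \<le> b * norm x"
    using assms(1) by (auto simp: gauge_function_def)
  have "d * a > 0" "d * b > 0" using ab(1,3) assms(2) by auto
  moreover have "(d * a) * norm x \<le> d * p x" "d * p x \<le> (d * b) * norm x" for x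
    using ab(2,4)[of x] assms(2) by (simp_all add: mult.assoc)
  moreover have "d * p (x + y) \<le> d * p x + d * p y" for x y
    using gauge_functionD(1)[OF assms(1), of x y] assms(2)
    by (simp flip: distrib_left)
  moreover have "d * p (c *\<^sub>R x) = c * (d * p x)" if "0 \<le> c" for c x
    using gauge_functionD(2)[OF assms(1) that, of x] by simp
  ultimately show ?thesis
    unfolding gauge_function_def by blast
qed

lemma luc_gauge_scale:
  assumes "luc_gauge p" "d > 0"
  shows "luc_gauge (\<lambda>x. d * p x)"
  unfolding luc_gauge_def
proof (intro allI impI)
  fix x xs
  assume 1: "(\<lambda>n. d * p (xs n)) \<longlonglongrightarrow> d * p x" and 2: "(\<lambda>n. d * p (x + xs n)) \<longlonglongrightarrow> 2 * (d * p x)"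
  have "(\<lambda>n. p (xs n)) \<longlonglongrightarrow> p x" "(\<lambda>n. p (x + xs n)) \<longlonglongrightarrow> 2 * p x"
    using tendsto_mult_left[OF 1, of "1 / d"] tendsto_mult_left[OF 2, of "1 / d"] assms(2) by simp_all
  then show "xs \<longlonglongrightarrow> x"
    using assms(1) by (simp add: luc_gauge_def)
qed

text \<open>The new function is the Euclidean norm of the pair \<open>(f x, g x)\<close>. That norm
  is monotone on nonnegative pairs, so subadditivity of \<open>f\<close> and \<open>g\<close> passes
  to it.\<close>

lemma gauge_function_quadratic_sum:
  assumes f: "gauge_function f" and g: "gauge_function g"
  shows "gauge_function (\<lambda>x. sqrt ((f x)\<^sup>2 + (g x)\<^sup>2))" (is "gauge_function ?q")
proof -
  note fn = gauge_functionD(3)[OF f] and gn = gauge_functionD(3)[OF g]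
  obtain a where a: "a > 0" "\<And>x. a * norm x \<le> f x"
    using f by (auto simp: gauge_function_def)
  obtain b where b: "b > 0" "\<And>x. f x \<le> b * norm x"
    using f by (auto simp: gauge_function_def)
  obtain c where c: "c > 0" "\<And>x. g x \<le> c * norm x"
    using g by (auto simp: gauge_function_def)
  have "?q (x + y) \<le> ?q x + ?q y" for x y
  proof -
    have "?q (x + y) \<le> sqrt ((f x + f y)\<^sup>2 + (g x + g y)\<^sup>2)"
      using gauge_functionD(1)[OF f, of x y] gauge_functionD(1)[OF g, of x y] fn gn
      by (intro real_sqrt_le_mono add_mono power_mono) auto
    also have "\<dots> \<le> ?q x + ?q y"
      by (rule real_sqrt_sum_squares_triangle_ineq)
    finally show ?thesis .
  qed
  moreover have "?q (t *\<^sub>R x) = t * ?q x" if "0 \<le> t" for t x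
  proof -
    have "(f (t *\<^sub>R x))\<^sup>2 + (g (t *\<^sub>R x))\<^sup>2 = t\<^sup>2 * ((f x)\<^sup>2 + (g x)\<^sup>2)"
      using gauge_functionD(2)[OF f that, of x] gauge_functionD(2)[OF g that, of x]
      by (simp add: power_mult_distrib distrib_left)
    then show ?thesis using that by (simp add: real_sqrt_mult)
  qed
  moreover have "a * norm x \<le> ?q x" for x
    using a(2)[of x] real_sqrt_sum_squares_ge1[of "f x" "g x"] by linarith
  moreover have "?q x \<le> (b + c) * norm x" for x
    using sqrt_sum_squares_le_sum[of "f x" "g x"] fn[of x] gn[of x] b(2)[of x] c(2)[of x]
    by (simp add: distrib_right)
  moreover have "b + c > 0" using b(1) c(1) by simp
  ultimately show ?thesis
    using a(1) unfolding gauge_function_def by blast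
qed

text \<open>With \<open>f x + f y\<close> in place of \<open>f (x + y)\<close> the right-hand side
  would equal the left one; subadditivity only enlarges it.\<close>

lemma gauge_function_parallelogram_defect:
  assumes "gauge_function f"
  shows "(f x - f y)\<^sup>2 \<le> 2 * (f x)\<^sup>2 + 2 * (f y)\<^sup>2 - (f (x + y))\<^sup>2"
proof -
  have "(f (x + y))\<^sup>2 \<le> (f x + f y)\<^sup>2"
    using gauge_functionD(1,3)[OF assms] by (intro power_mono) auto
  then show ?thesis by (simp add: power2_eq_square algebra_simps)
qed

lemma luc_gauge_quadratic_sum:
  assumes f: "gauge_function f" and g: "gauge_function g" and luc: "luc_gauge f"
  shows "luc_gauge (\<lambda>x. sqrt ((f x)\<^sup>2 + (g x)\<^sup>2))"
  unfolding luc_gauge_def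
proof (intro allI impI)
  define q where "q x = sqrt ((f x)\<^sup>2 + (g x)\<^sup>2)" for x
  fix x xs
  assume "(\<lambda>n. sqrt ((f (xs n))\<^sup>2 + (g (xs n))\<^sup>2)) \<longlonglongrightarrow> sqrt ((f x)\<^sup>2 + (g x)\<^sup>2)"
    and "(\<lambda>n. sqrt ((f (x + xs n))\<^sup>2 + (g (x + xs n))\<^sup>2)) \<longlonglongrightarrow> 2 * sqrt ((f x)\<^sup>2 + (g x)\<^sup>2)"
  then have l1: "(\<lambda>n. q (xs n)) \<longlonglongrightarrow> q x" and l2: "(\<lambda>n. q (x + xs n)) \<longlonglongrightarrow> 2 * q x"
    by (simp_all add: q_def)
  have q2: "(q z)\<^sup>2 = (f z)\<^sup>2 + (g z)\<^sup>2" for z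
    by (simp add: q_def)
  \<comment> \<open>\<open>F\<close> and \<open>G\<close> are the parallelogram defects of
    \<open>f\<close> and \<open>g\<close>. Both are nonnegative and their sum is the defect of
    \<open>q\<close>, which tends to 0; hence \<open>F\<close> alone tends to 0.\<close>
  define F where "F n = 2 * (f x)\<^sup>2 + 2 * (f (xs n))\<^sup>2 - (f (x + xs n))\<^sup>2" for n
  define G where "G n = 2 * (g x)\<^sup>2 + 2 * (g (xs n))\<^sup>2 - (g (x + xs n))\<^sup>2" for n
  have F: "(f x - f (xs n))\<^sup>2 \<le> F n" for n
    unfolding F_def by (rule gauge_function_parallelogram_defect[OF f])
  have "(g x - g (xs n))\<^sup>2 \<le> G n" for n
    unfolding G_def by (rule gauge_function_parallelogram_defect[OF g])
  then have G: "0 \<le> G n" for n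
    using order_trans[OF zero_le_power2] by blast
  have "(\<lambda>n. 2 * (q x)\<^sup>2 + 2 * (q (xs n))\<^sup>2 - (q (x + xs n))\<^sup>2) \<longlonglongrightarrow> 2 * (q x)\<^sup>2 + 2 * (q x)\<^sup>2 - (2 * q x)\<^sup>2"
    by (intro tendsto_intros l1 l2)
  then have FG: "(\<lambda>n. F n + G n) \<longlonglongrightarrow> 0"
    by (simp add: F_def G_def q2 power_mult_distrib algebra_simps)
  have F0: "F \<longlonglongrightarrow> 0"
  proof (rule tendsto_sandwich[OF _ _ tendsto_const FG])
    show "\<forall>\<^sub>F n in sequentially. 0 \<le> F n"
      using F order_trans[OF zero_le_power2] by (intro always_eventually) blast
    show "\<forall>\<^sub>F n in sequentially. F n \<le> F n + G n"
      using G by simp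
  qed
  have "(\<lambda>n. (f x - f (xs n))\<^sup>2) \<longlonglongrightarrow> 0"
    by (rule tendsto_sandwich[OF _ _ tendsto_const F0]) (simp_all add: F)
  from tendsto_real_sqrt[OF this] have "(\<lambda>n. f x - f (xs n)) \<longlonglongrightarrow> 0"
    by (simp add: tendsto_rabs_zero_iff)
  from tendsto_diff[OF tendsto_const[of "f x"] this]
  have f1: "(\<lambda>n. f (xs n)) \<longlonglongrightarrow> f x" by simp
  \<comment> \<open>The radicand is the square of \<open>f (x + xs n)\<close>, by the definition of
    \<open>F\<close>, so the vanishing defect yields the second limit required by
    \<open>luc_gauge f\<close>.\<close>
  have "(\<lambda>n. sqrt (2 * (f x)\<^sup>2 + 2 * (f (xs n))\<^sup>2 - F n)) \<longlonglongrightarrow> sqrt (2 * (f x)\<^sup>2 + 2 * (f x)\<^sup>2 - 0)"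
    by (intro tendsto_intros f1 F0)
  moreover have "sqrt (2 * (f x)\<^sup>2 + 2 * (f x)\<^sup>2 - 0) = 2 * f x"
    using gauge_functionD(3)[OF f, of x] by (intro real_sqrt_unique) (simp_all add: power_mult_distrib)
  ultimately have "(\<lambda>n. f (x + xs n)) \<longlonglongrightarrow> 2 * f x"
    using gauge_functionD(3)[OF f] by (simp add: F_def)
  with f1 show "xs \<longlonglongrightarrow> x"
    using luc by (simp add: luc_gauge_def)
qed

section \<open>Minkowski functionals and unit balls\<close>

text \<open>Convexity and \<open>0 \<in> D\<close> make the set of admissible scalings upward
  closed, and closedness of \<open>D\<close> lets a positive infimum be attained. Later proofs use
  this criterion in place of the infimum.\<close>

lemma minkowski_functional_le_iff:
  fixes D :: "'a::real_normed_vector set"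
  assumes D: "closed D" "convex D" "0 \<in> interior D" and t: "0 < t"
  shows "minkowski_functional D x \<le> t \<longleftrightarrow> (1 / t) *\<^sub>R x \<in> D"
proof -
  have mem: "x \<in> (*\<^sub>R) s ` D \<longleftrightarrow> (1 / s) *\<^sub>R x \<in> D" if "0 < s" for s
  proof
    assume "(1 / s) *\<^sub>R x \<in> D"
    then have "s *\<^sub>R ((1 / s) *\<^sub>R x) \<in> (*\<^sub>R) s ` D" by (rule imageI)
    with that show "x \<in> (*\<^sub>R) s ` D" by simp
  qed (use that in auto)
  have D0: "0 \<in> D" using D(3) interior_subset by blast
  define S where "S = {s. 0 < s \<and> (1 / s) *\<^sub>R x \<in> D}"
  have p: "minkowski_functional D x = Inf S"
    unfolding minkowski_functional_def S_def using mem by (metis (no_types, lifting))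
  have bdd: "bdd_below S"
    by (rule bdd_belowI[of _ 0]) (auto simp: S_def)
  have ne: "S \<noteq> {}"
  proof -
    obtain r where r: "r > 0" "ball 0 r \<subseteq> D"
      using D(3) by (auto simp: mem_interior)
    \<comment> \<open>Any \<open>s\<close> with \<open>norm x < r * s\<close> would do; the
      \<open>+ 1\<close> makes it strict and keeps \<open>s\<close> positive for
      \<open>x = 0\<close>.\<close>
    define s where "s = (norm x + 1) / r"
    have s: "s > 0" using r(1) norm_ge_zero[of x] by (simp add: s_def add_nonneg_pos)
    have "norm x < r * s" using r(1) by (simp add: s_def)
    then have "(1 / s) *\<^sub>R x \<in> ball 0 r"
      using s by (simp add: divide_less_eq)
    with s r(2) have "s \<in> S" by (auto simp: S_def)
    then show ?thesis by blast
  qed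
  have up: "(1 / s) *\<^sub>R x \<in> D" if "Inf S < s" for s
  proof -
    obtain u where u: "u \<in> S" "u < s" using cInf_lessD[OF ne \<open>Inf S < s\<close>] by blast
    \<comment> \<open>The point \<open>x / s\<close> lies on the segment from 0 to
      \<open>x / u\<close>.\<close>
    then have "(u / s) *\<^sub>R ((1 / u) *\<^sub>R x) + (1 - u / s) *\<^sub>R 0 \<in> D"
      by (intro convexD[OF D(2)]) (use D0 in \<open>auto simp: S_def\<close>)
    with u show ?thesis by (simp add: S_def)
  qed
  show ?thesis
  proof
    assume "minkowski_functional D x \<le> t"
    then have le: "Inf S \<le> t" by (simp add: p)
    \<comment> \<open>Approach \<open>t\<close> from above by levels strictly greater than the
      infimum, then use closedness.\<close>
    have inD: "(1 / (t + 1 / real (Suc n))) *\<^sub>R x \<in> D" for n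
      by (rule up, rule le_less_trans[OF le]) simp
    have "(\<lambda>n. (1 / (t + 1 / real (Suc n))) *\<^sub>R x) \<longlonglongrightarrow> (1 / (t + 0)) *\<^sub>R x"
      using t by (intro tendsto_intros LIMSEQ_Suc[OF lim_1_over_n]) auto
    then show "(1 / t) *\<^sub>R x \<in> D"
      using closed_sequentially[OF D(1) inD] by simp
  next
    assume "(1 / t) *\<^sub>R x \<in> D"
    then have "t \<in> S" using t by (simp add: S_def)
    then show "minkowski_functional D x \<le> t"
      unfolding p by (rule cInf_lower[OF _ bdd])
  qed
qed

text \<open>Passes from bodies to gauges; \<open>convex_body_gauge_ball\<close> is the way
  back.\<close>

lemma gauge_function_minkowski_functional:
  assumes body: "convex_body D" and 0: "0 \<in> interior D"
  shows "gauge_function (minkowski_functional D)" "{x. minkowski_functional D x \<le> 1} = D"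
proof -
  define p where "p = minkowski_functional D"
  have D: "closed D" "convex D" "bounded D"
    using body by (auto simp: convex_body_def)
  have le: "p x \<le> t \<longleftrightarrow> (1 / t) *\<^sub>R x \<in> D" if "0 < t" for x t
    unfolding p_def by (rule minkowski_functional_le_iff[OF D(1,2) 0 that])
  obtain r where r: "r > 0" "ball 0 r \<subseteq> D"
    using 0 by (auto simp: mem_interior)
  obtain R where R: "R > 0" "\<And>x. x \<in> D \<Longrightarrow> norm x \<le> R"
    using D(3) by (auto simp: bounded_pos)
  have norm_le: "norm x \<le> R * t" if "0 < t" "p x \<le> t" for x t
    using R(2)[of "(1 / t) *\<^sub>R x"] that by (simp add: le divide_le_eq)
  have nn: "0 \<le> p x" for x
  proof (rule ccontr)
    assume "\<not> 0 \<le> p x"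
    \<comment> \<open>then \<open>x / t \<in> D\<close> for all \<open>t > 0\<close>, so \<open>x = 0\<close> by boundedness, and \<open>p 0\<close> is the infimum of
      all positive reals\<close>
    then have "norm x \<le> R * (e / R)" if "e > 0" for e
      using norm_le[of "e / R" x] that R(1) divide_pos_pos[OF that R(1)] by linarith
    then have "norm x \<le> 0 + e" if "e > 0" for e
      using R(1) that by simp
    then have "norm x \<le> 0" by (rule field_le_epsilon)
    then have "x = 0" by simp
    moreover have "p 0 = 0"
    proof -
      have "t *\<^sub>R 0 \<in> (*\<^sub>R) t ` D" for t
        using 0 interior_subset by (intro imageI) blast
      then have "{t. 0 < t \<and> 0 \<in> (*\<^sub>R) t ` D} = {0<..}" by auto
      then show ?thesis by (simp add: p_def minkowski_functional_def)
    qed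
    ultimately show False using \<open>\<not> 0 \<le> p x\<close> by simp
  qed
  have lower: "(1 / R) * norm x \<le> p x" for x
  proof -
    have "norm x / R \<le> p x + e" if "e > 0" for e
      using norm_le[of "p x + e" x] nn[of x] that R(1) by (simp add: divide_le_eq mult.commute)
    then have "norm x / R \<le> p x" by (rule field_le_epsilon)
    then show ?thesis by simp
  qed
  have upper: "p x \<le> (2 / r) * norm x" for x
  proof (cases "x = 0")
    case True
    have "0 \<in> D" using 0 interior_subset by blast
    then have "p 0 \<le> 0 + e" if "e > 0" for e using le[OF that, of 0] by simp
    then have "p 0 \<le> 0" by (rule field_le_epsilon)
    then show ?thesis using True by simp
  next
    case False
    \<comment> \<open>The factor 2 gives the rescaled vector norm \<open>r / 2\<close>, hence a
      place in the open ball.\<close>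
    then have "(1 / ((2 / r) * norm x)) *\<^sub>R x \<in> ball 0 r" using r(1) by simp
    then show ?thesis using r False by (subst le) auto
  qed
  have add: "p (x + y) \<le> p x + p y" for x y
  proof (rule field_le_epsilon)
    fix e :: real assume e: "e > 0"
    \<comment> \<open>The criterion \<open>le\<close> speaks of positive levels only, and
      \<open>p x\<close> may vanish; the slack \<open>e / 2\<close> keeps both levels
      positive.\<close>
    define s where "s = p x + e / 2"
    define t where "t = p y + e / 2"
    have st: "s > 0" "t > 0" using nn[of x] nn[of y] e by (simp_all add: s_def t_def)
    have "(1 / s) *\<^sub>R x \<in> D" "(1 / t) *\<^sub>R y \<in> D"
      using le[OF st(1), of x] le[OF st(2), of y] e by (simp_all add: s_def t_def)
    moreover have "s / (s + t) + t / (s + t) = 1"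
      using st by (simp flip: add_divide_distrib)
    \<comment> \<open>These weights make the combination equal to
      \<open>(x + y) / (s + t)\<close>.\<close>
    ultimately have "(s / (s + t)) *\<^sub>R ((1 / s) *\<^sub>R x) + (t / (s + t)) *\<^sub>R ((1 / t) *\<^sub>R y) \<in> D"
      using st by (intro convexD[OF D(2)]) auto
    then have "p (x + y) \<le> s + t" using st by (simp add: le scaleR_add_right)
    then show "p (x + y) \<le> p x + p y + e" by (simp add: s_def t_def)
  qed
  \<comment> \<open>Used for \<open>c\<close> and for \<open>1 / c\<close>, this inequality gives
    equality.\<close>
  have hom_le: "p (c *\<^sub>R x) \<le> c * p x" if "0 < c" for c x
  proof (rule field_le_epsilon)
    fix e :: real assume e: "e > 0"
    define t where "t = p x + e / c"
    have t: "t > 0" using nn[of x] e that by (simp add: t_def add_nonneg_pos)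
    have "(1 / t) *\<^sub>R x \<in> D" using le[OF t, of x] e that by (simp add: t_def)
    then have "p (c *\<^sub>R x) \<le> c * t" using t that by (subst le) auto
    then show "p (c *\<^sub>R x) \<le> c * p x + e" using that by (simp add: t_def distrib_left)
  qed
  have hom: "p (c *\<^sub>R x) = c * p x" if "0 \<le> c" for c x
  proof (cases "c = 0")
    case True
    then show ?thesis using upper[of 0] nn[of 0] by simp
  next
    case False
    then have c: "c > 0" using that by simp
    have "p x \<le> (1 / c) * p (c *\<^sub>R x)" using hom_le[of "1 / c" "c *\<^sub>R x"] c by simp
    then show ?thesis using hom_le[OF c, of x] c by (simp add: field_simps)
  qed
  have "1 / R > 0" "2 / r > 0" using R(1) r(1) by simp_all
  then have "gauge_function p"
    unfolding gauge_function_def using add hom lower upper by blast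
  then show "gauge_function (minkowski_functional D)" by (simp add: p_def)
  show "{x. minkowski_functional D x \<le> 1} = D"
    using le[of 1] by (auto simp: p_def)
qed

text \<open>An interior point can be pushed outward along its ray without leaving the unit ball,
  which forces its gauge below 1.\<close>

lemma interior_gauge_ball:
  assumes p: "gauge_function p"
  shows "interior {x. p x \<le> 1} = {x. p x < 1}"
proof
  have "open {x. p x < 1}"
    by (rule open_Collect_less[OF gauge_function_continuous[OF p] continuous_on_const])
  then show "{x. p x < 1} \<subseteq> interior {x. p x \<le> 1}"
    by (rule interior_maximal[rotated]) auto
  show "interior {x. p x \<le> 1} \<subseteq> {x. p x < 1}"
  proof
    fix x assume "x \<in> interior {x. p x \<le> 1}"
    then obtain e where e: "e > 0" "ball x e \<subseteq> {x. p x \<le> 1}"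
      by (auto simp: mem_interior)
    \<comment> \<open>Chosen so that \<open>norm (d *\<^sub>R x)\<close> is less than
      \<open>e\<close>, with \<open>+ 1\<close> covering \<open>x = 0\<close>.\<close>
    define d where "d = e / (norm x + 1)"
    have n1: "norm x + 1 > 0" using norm_ge_zero[of x] by linarith
    have d: "d > 0" using e(1) n1 by (simp add: d_def)
    have "norm (d *\<^sub>R x) < e"
      using d e(1) n1 by (simp add: d_def divide_less_eq)
    then have "(1 + d) *\<^sub>R x \<in> ball x e"
      by (simp add: dist_norm scaleR_add_left)
    then have "p ((1 + d) *\<^sub>R x) \<le> 1" using e(2) by blast
    then have "(1 + d) * p x \<le> 1"
      using gauge_functionD(2)[OF p, of "1 + d" x] d by simp
    then have "p x + d * p x \<le> 1" by (simp add: distrib_right)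
    moreover have "d * p x > 0" if "p x \<ge> 1" using d that by simp
    ultimately show "x \<in> {x. p x < 1}" by force
  qed
qed

lemma convex_body_gauge_ball:
  assumes p: "gauge_function p"
  shows "convex_body {x. p x \<le> 1}" "0 \<in> interior {x. p x \<le> 1}"
    "frontier {x. p x \<le> 1} = {x. p x = 1}" "minkowski_functional {x. p x \<le> 1} = p"
proof -
  have cl: "closed {x. p x \<le> 1}"
    by (rule closed_Collect_le[OF gauge_function_continuous[OF p] continuous_on_const])
  obtain a where a: "a > 0" "\<And>x. a * norm x \<le> p x"
    using p by (auto simp: gauge_function_def)
  have "norm x \<le> 1 / a" if "p x \<le> 1" for x
    using a(1) order_trans[OF a(2)[of x] that] by (simp add: pos_le_divide_eq mult.commute)
  then have bd: "bounded {x. p x \<le> 1}"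
    by (auto simp: bounded_iff)
  have cv: "convex {x. p x \<le> 1}"
  proof (rule convexI)
    fix x y and u v :: real
    assume H: "x \<in> {x. p x \<le> 1}" "y \<in> {x. p x \<le> 1}" "0 \<le> u" "0 \<le> v" "u + v = 1"
    have "p (u *\<^sub>R x + v *\<^sub>R y) \<le> u * p x + v * p y"
      using gauge_functionD(1)[OF p, of "u *\<^sub>R x" "v *\<^sub>R y"] gauge_functionD(2)[OF p] H by simp
    also have "\<dots> \<le> 1"
      using H by (intro convex_bound_le) auto
    finally show "u *\<^sub>R x + v *\<^sub>R y \<in> {x. p x \<le> 1}" by simp
  qed
  show 0: "0 \<in> interior {x. p x \<le> 1}"
    by (simp add: interior_gauge_ball[OF p] gauge_functionD(4)[OF p])
  then show "convex_body {x. p x \<le> 1}"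
    using cl bd cv by (auto simp: convex_body_def)
  show "frontier {x. p x \<le> 1} = {x. p x = 1}"
    using cl by (auto simp: frontier_def interior_gauge_ball[OF p])
  show "minkowski_functional {x. p x \<le> 1} = p"
  proof
    fix x
    have iff: "minkowski_functional {x. p x \<le> 1} x \<le> t \<longleftrightarrow> p x \<le> t" if "0 < t" for t
      using minkowski_functional_le_iff[OF cl cv 0 that, of x] that
        gauge_functionD(2)[OF p, of "1 / t" x] by (simp add: divide_le_eq)
    have "0 \<le> minkowski_functional {x. p x \<le> 1} x"
      using gauge_functionD(3)[OF gauge_function_minkowski_functional(1)]
        \<open>convex_body {x. p x \<le> 1}\<close> 0 by blast
    \<comment> \<open>If the two values differed, their midpoint would be a positive level
      separating them, against \<open>iff\<close>.\<close>
    then have "\<not> minkowski_functional {x. p x \<le> 1} x < p x" "\<not> p x < minkowski_functional {x. p x \<le> 1} x"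
      using iff[of "(p x + minkowski_functional {x. p x \<le> 1} x) / 2"] gauge_functionD(3)[OF p, of x]
      by auto
    then show "minkowski_functional {x. p x \<le> 1} x = p x" by simp
  qed
qed

text \<open>The frontier is the unit sphere of \<open>p\<close>, so the condition on the body is the
  normalised form of \<open>luc_gauge\<close>, and \<open>luc_gaugeI\<close> supplies the
  homogeneous one.\<close>

lemma luc_body_gauge_ball_iff:
  assumes p: "gauge_function p"
  shows "luc_body_at_origin {x. p x \<le> 1} \<longleftrightarrow> luc_gauge p"
proof
  assume "luc_body_at_origin {x. p x \<le> 1}"
  then show "luc_gauge p"
    by (intro luc_gaugeI[OF p])
       (auto simp: luc_body_at_origin_def convex_body_gauge_ball(3,4)[OF p])
next
  assume "luc_gauge p"
  then show "luc_body_at_origin {x. p x \<le> 1}"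
    using convex_body_gauge_ball(1,2)[OF p]
    by (auto simp: luc_body_at_origin_def convex_body_gauge_ball(3,4)[OF p] luc_gauge_def)
qed

lemma luc_gauge_minkowski_functional:
  assumes "luc_body_at_origin D"
  shows "luc_gauge (minkowski_functional D)"
proof -
  have D: "convex_body D" "0 \<in> interior D"
    using assms by (auto simp: luc_body_at_origin_def)
  show ?thesis
    using luc_body_gauge_ball_iff[OF gauge_function_minkowski_functional(1)[OF D]] assms
    by (simp add: gauge_function_minkowski_functional(2)[OF D])
qed

lemma convex_body_translation:
  assumes "convex_body B"
  shows "convex_body ((+) z ` B)"
  using assms
  by (auto simp: convex_body_def closed_translation bounded_translation convex_translation
      interior_translation)

lemma locally_uniformly_convex_body_translation:
  assumes "luc_body_at_origin C"
  shows "locally_uniformly_convex_body ((+) z ` C)"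
proof -
  have C: "convex_body C" "0 \<in> interior C"
    using assms by (auto simp: luc_body_at_origin_def)
  have "z \<in> interior ((+) z ` C)"
    using imageI[OF C(2), of "(+) z"] by (simp add: interior_translation)
  moreover have "(\<lambda>x. x - z) ` (+) z ` C = C"
    by (simp add: image_image)
  ultimately show ?thesis
    unfolding locally_uniformly_convex_body_def
    by (intro conjI convex_body_translation[OF C(1)] bexI[of _ z]) (simp_all only: assms)
qed

section \<open>Equivalent norms, and a norm built from a body\<close>

lemma gauge_function_norm:
  assumes "equivalent_norm N"
  shows "gauge_function N"
proof -
  have "N (c *\<^sub>R x) = c * N x" if "0 \<le> c" for c x
    using assms that by (simp add: equivalent_norm_def is_norm_def)
  moreover have "N (x + y) \<le> N x + N y" for x y
    using assms by (simp add: equivalent_norm_def is_norm_def)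
  moreover have "(\<exists>a>0. \<forall>x. a * norm x \<le> N x) \<and> (\<exists>b>0. \<forall>x. N x \<le> b * norm x)"
    using assms unfolding equivalent_norm_def by blast
  ultimately show ?thesis
    unfolding gauge_function_def by simp
qed

lemma locally_uniformly_convex_norm_iff:
  assumes N: "equivalent_norm N"
  shows "locally_uniformly_convex_norm N \<longleftrightarrow> luc_gauge N"
proof -
  note g = gauge_function_norm[OF N]
  have isn: "is_norm N" using N by (simp add: equivalent_norm_def)
  \<comment> \<open>Equivalence of \<open>N\<close> identifies convergence in \<open>N\<close>, as
    in the definition for norms, with ambient convergence, as in \<open>luc_gauge\<close>.\<close>
  have conv: "(\<lambda>n. N (xs n - x)) \<longlonglongrightarrow> 0 \<longleftrightarrow> xs \<longlonglongrightarrow> x" for xs x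
  proof
    assume "(\<lambda>n. N (xs n - x)) \<longlonglongrightarrow> 0"
    then show "xs \<longlonglongrightarrow> x"
      by (rule gauge_function_null_sequence[OF g, THEN LIM_zero_cancel])
  next
    assume "xs \<longlonglongrightarrow> x"
    then have "(\<lambda>n. (xs n - x) - 0) \<longlonglongrightarrow> 0" by (simp add: LIM_zero)
    then show "(\<lambda>n. N (xs n - x)) \<longlonglongrightarrow> 0"
      by (rule gauge_function_tendsto[OF g]) (simp add: gauge_functionD(4)[OF g])
  qed
  show ?thesis
  proof
    assume "locally_uniformly_convex_norm N"
    then show "luc_gauge N"
      by (intro luc_gaugeI[OF g]) (simp add: locally_uniformly_convex_norm_def conv)
  next
    assume "luc_gauge N"
    then show "locally_uniformly_convex_norm N"
      using isn by (auto simp: locally_uniformly_convex_norm_def conv luc_gauge_def)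
  qed
qed

lemma luc_norm_of_luc_body:
  fixes D :: "'a::real_normed_vector set"
  assumes D: "luc_body_at_origin D"
  shows "\<exists>N :: 'a \<Rightarrow> real. equivalent_norm N \<and> locally_uniformly_convex_norm N"
proof -
  define p where "p = minkowski_functional D"
  have p: "gauge_function p" "luc_gauge p"
    using D gauge_function_minkowski_functional(1) luc_gauge_minkowski_functional
    by (auto simp: p_def luc_body_at_origin_def)
  define N where "N x = sqrt ((p x)\<^sup>2 + (p (- x))\<^sup>2)" for x
  have N: "gauge_function N" "luc_gauge N"
    unfolding N_def
    using gauge_function_quadratic_sum[OF p(1) gauge_function_uminus[OF p(1)]]
      luc_gauge_quadratic_sum[OF p(1) gauge_function_uminus[OF p(1)] p(2)] by simp_all
  \<comment> \<open>Evenness upgrades positive homogeneity to absolute homogeneity.\<close>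
  have sym: "N (- x) = N x" for x
    by (simp add: N_def add.commute)
  have "N (c *\<^sub>R x) = \<bar>c\<bar> * N x" for c x
  proof (cases "0 \<le> c")
    case True
    then show ?thesis using gauge_functionD(2)[OF N(1)] by simp
  next
    case False
    then have "N (c *\<^sub>R x) = N ((- c) *\<^sub>R x)" using sym[of "c *\<^sub>R x"] by simp
    with False show ?thesis using gauge_functionD(2)[OF N(1), of "- c" x] by simp
  qed
  then have "is_norm N"
    using gauge_functionD[OF N(1)] by (simp add: is_norm_def)
  then have "equivalent_norm N"
    using N(1) unfolding equivalent_norm_def gauge_function_def by blast
  then show ?thesis
    using N(2) locally_uniformly_convex_norm_iff by blast
qed

section \<open>Approximation of a given body\<close>

text \<open>Since \<open>p \<le> q\<close>, the new body \<open>C\<close> lies inside the translate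
  \<open>D\<close> of \<open>B\<close>. On \<open>D\<close> one has \<open>q \<le> 1 + s\<close> for
  a small \<open>s\<close>, so shrinking a point of \<open>D\<close> by the factor
  \<open>1 + s\<close> lands it in \<open>C\<close> and moves it only slightly.\<close>

lemma luc_body_approximation:
  fixes B :: "'a::real_normed_vector set" and N :: "'a \<Rightarrow> real"
  assumes N: "gauge_function N" "luc_gauge N" and B: "convex_body B" and e: "e > 0"
  shows "\<exists>C. locally_uniformly_convex_body C \<and> hausdorff_distance B C < e"
proof -
  obtain z where z: "z \<in> interior B" using B by (auto simp: convex_body_def)
  define D where "D = (+) (- z) ` B"
  have BD: "B = (+) z ` D" by (simp add: D_def image_image)
  have D: "convex_body D" unfolding D_def by (rule convex_body_translation[OF B])
  have D0: "0 \<in> interior D"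
    unfolding D_def interior_translation by (rule image_eqI[OF _ z]) simp
  define p where "p = minkowski_functional D"
  have p: "gauge_function p" and pD: "{x. p x \<le> 1} = D"
    using gauge_function_minkowski_functional[OF D D0] by (simp_all add: p_def)
  obtain R where R: "R > 0" "\<And>x. x \<in> D \<Longrightarrow> norm x \<le> R"
    using D by (auto simp: convex_body_def bounded_pos)
  obtain b where b: "b > 0" "\<And>x. N x \<le> b * norm x"
    using N(1) by (auto simp: gauge_function_def)
  \<comment> \<open>Makes \<open>d * (b * R)\<close>, a bound for \<open>d * N\<close> on
    \<open>D\<close>, equal to \<open>(e / 2) / R\<close>, which is the \<open>s\<close>
    below.\<close>
  define d where "d = e / (2 * R * b * R)"
  have d: "d > 0" using e R(1) b(1) by (simp add: d_def)
  define q where "q x = sqrt ((d * N x)\<^sup>2 + (p x)\<^sup>2)" for x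
  have dN: "gauge_function (\<lambda>x. d * N x)" "luc_gauge (\<lambda>x. d * N x)"
    using gauge_function_scale[OF N(1) d] luc_gauge_scale[OF N(2) d] .
  have q: "gauge_function q" "luc_gauge q"
    unfolding q_def using gauge_function_quadratic_sum[OF dN(1) p]
      luc_gauge_quadratic_sum[OF dN(1) p dN(2)] .
  define C where "C = {x. q x \<le> 1}"
  have luc: "locally_uniformly_convex_body ((+) z ` C)"
    unfolding C_def
    by (rule locally_uniformly_convex_body_translation)
       (simp add: luc_body_gauge_ball_iff[OF q(1)] q(2))
  have "p x \<le> q x" for x
    unfolding q_def by (rule real_sqrt_sum_squares_ge2)
  then have CD: "C \<subseteq> D"
    unfolding C_def pD[symmetric] using order_trans by blast
  \<comment> \<open>Admissibility of \<open>r\<close> bounds the infimum only by \<open>r\<close>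
    itself; the half makes the final inequality strict.\<close>
  define r where "r = e / 2"
  have r: "0 < r" "r < e" using e by (simp_all add: r_def)
  have cball: "y \<in> (*\<^sub>R) r ` cball 0 1" if "norm y \<le> r" for y :: 'a
    using imageI[of "(1 / r) *\<^sub>R y" "cball 0 1" "(*\<^sub>R) r"] that r(1) by simp
  have sum: "y + w \<in> closure (A + (*\<^sub>R) r ` cball 0 1)" if "y \<in> A" "norm w \<le> r" for y w and A :: "'a set"
    using closure_subset set_plus_intro[OF that(1) cball[OF that(2)]] by blast
  have 1: "(+) z ` C \<subseteq> closure (B + (*\<^sub>R) r ` cball 0 1)"
  proof
    fix y assume "y \<in> (+) z ` C"
    then have "y \<in> B" using CD by (auto simp: BD)
    then show "y \<in> closure (B + (*\<^sub>R) r ` cball 0 1)"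
      using sum[of y B 0] r(1) by simp
  qed
  have 2: "B \<subseteq> closure ((+) z ` C + (*\<^sub>R) r ` cball 0 1)"
  proof
    fix y assume "y \<in> B"
    then obtain x where x: "y = z + x" "x \<in> D" by (auto simp: BD)
    define s where "s = r / R"
    have s: "s > 0" using r(1) R(1) by (simp add: s_def)
    have "N x \<le> b * R"
      using b R(2)[OF x(2)] order_trans[OF b(2)[of x]] by simp
    then have "d * N x \<le> d * (b * R)" using d by simp
    also have "\<dots> = s" using R(1) b(1) by (simp add: d_def s_def r_def)
    finally have "d * N x \<le> s" .
    moreover have "p x \<le> 1" using x(2) pD by blast
    ultimately have "q x \<le> s + 1"
      using sqrt_sum_squares_le_sum[of "d * N x" "p x"] gauge_functionD(3)[OF dN(1), of x]
        gauge_functionD(3)[OF p, of x] by (simp add: q_def)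
    then have "q ((1 / (1 + s)) *\<^sub>R x) \<le> 1"
      using s gauge_functionD(2)[OF q(1), of "1 / (1 + s)" x] by (simp add: divide_le_eq)
    then have in_C: "z + (1 / (1 + s)) *\<^sub>R x \<in> (+) z ` C" by (simp add: C_def)
    have "x - (1 / (1 + s)) *\<^sub>R x = (1 - 1 / (1 + s)) *\<^sub>R x"
      by (simp add: scaleR_diff_left)
    moreover have "1 - 1 / (1 + s) = s / (1 + s)"
      using s by (simp add: field_simps)
    moreover have "s / (1 + s) * norm x \<le> s * R"
      using s R(1) R(2)[OF x(2)] by (intro mult_mono) (simp_all add: divide_le_eq)
    moreover have "s * R = r" using R(1) by (simp add: s_def)
    ultimately have "norm (x - (1 / (1 + s)) *\<^sub>R x) \<le> r"
      using s by simp
    from sum[OF in_C this] show "y \<in> closure ((+) z ` C + (*\<^sub>R) r ` cball 0 1)"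
      by (simp add: x(1))
  qed
  have "hausdorff_distance B ((+) z ` C) \<le> r"
    unfolding hausdorff_distance_def
    by (rule cInf_lower) (use r(1) 1 2 in \<open>auto intro: bdd_belowI[of _ 0]\<close>)
  then show ?thesis using luc r(2) by force
qed

theorem theorem1p1:
  shows "(\<forall>B :: 'a::banach set. \<forall>e > 0. convex_body B \<longrightarrow>
            (\<exists>C. locally_uniformly_convex_body C \<and> hausdorff_distance B C < e))
         \<longleftrightarrow>
         (\<exists>N :: 'a \<Rightarrow> real. equivalent_norm N \<and> locally_uniformly_convex_norm N)"
    (is "?approx \<longleftrightarrow> ?renorm")
proof
  assume ?approx
  \<comment> \<open>Approximating the closed unit ball with \<open>e = 1\<close> already yields a
    locally uniformly convex body, and one such body suffices for
    \<open>luc_norm_of_luc_body\<close>.\<close>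
  moreover have "convex_body (cball 0 1 :: 'a set)"
    using interior_maximal[OF ball_subset_cball open_ball, of "0::'a" 1] centre_in_ball[of "0::'a" 1]
    by (auto simp: convex_body_def)
  ultimately obtain C :: "'a set" where "locally_uniformly_convex_body C"
    using zero_less_one by metis
  then show ?renorm
    using luc_norm_of_luc_body by (auto simp: locally_uniformly_convex_body_def)
next
  assume ?renorm
  then obtain N :: "'a \<Rightarrow> real" where N: "equivalent_norm N" "locally_uniformly_convex_norm N"
    by blast
  have "luc_gauge N"
    using N locally_uniformly_convex_norm_iff by blast
  then show ?approx
    using luc_body_approximation[OF gauge_function_norm[OF N(1)]] by simp
qed

end
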